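(* Let $\tau>0$ be fixed and let $C_n$ be the cycle graph on $n$ vertices. Then, as $n\to\infty$, $$S(\varrho^\tau_{\mathcal L(C_n)})=\log n-\tau\,\frac{I_1(\tau)}{I_0(\tau)}+\log\big(I_0(\tau)\big)+o(1),$$ where $I_\alpha$ is the modified Bessel function of the first kind of order $\alpha$.
   Context: For a simple undirected graph $G$ with adjacency matrix $A(G)$ and diagonal degree matrix $D(G)$, let $L(G)=D(G)-A(G)$ be the Laplacian and $\mathcal L(G)=D(G)^{-1/2}L(G)D(G)^{-1/2}$ the normalized Laplacian. For a Hermitian matrix $H$ and real $\tau$, the Gibbs state is $\varrho_H^\tau=\exp(-\tau H)/\mathrm{Tr}(\exp(-\tau H))$, and $S(\varrho)=-\mathrm{Tr}(\varrho\log\varrho)$ is the von Neumann entropy (natural logarithm). $o(1)$ denotes a quantity converging to $0$. *)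

theory Defs
  imports
    "HOL-Analysis.Gamma_Function"
    "Jordan_Normal_Form.Schur_Decomposition"
begin

text \<open>A graph on \<open>n\<close> vertices is given by its edge set \<open>E\<close>, a set of two-element subsets of \<open>{0..<n}\<close>.\<close>

definition simple_graph :: "nat \<Rightarrow> nat set set \<Rightarrow> bool" where
  "simple_graph n E \<longleftrightarrow> (\<forall>e\<in>E. e \<subseteq> {0..<n} \<and> card e = 2)"

definition adjacency_matrix :: "nat \<Rightarrow> nat set set \<Rightarrow> complex mat" where
  "adjacency_matrix n E = mat n n (\<lambda>(i, j). if {i, j} \<in> E then 1 else 0)"

definition vertex_degree :: "nat set set \<Rightarrow> nat \<Rightarrow> nat" where
  "vertex_degree E v = card {e \<in> E. v \<in> e}"

definition degree_matrix :: "nat \<Rightarrow> nat set set \<Rightarrow> complex mat" where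
  "degree_matrix n E = mat_diag n (\<lambda>v. of_nat (vertex_degree E v))"

definition laplacian :: "nat \<Rightarrow> nat set set \<Rightarrow> complex mat" where
  "laplacian n E = degree_matrix n E - adjacency_matrix n E"

text \<open>The matrix \<open>D\<^sup>-\<^sup>1\<^sup>/\<^sup>2\<close>; an isolated vertex gets the entry \<open>0\<close>.\<close>

definition degree_inv_sqrt :: "nat \<Rightarrow> nat set set \<Rightarrow> complex mat" where
  "degree_inv_sqrt n E = mat_diag n (\<lambda>v. complex_of_real (1 / sqrt (real (vertex_degree E v))))"

definition normalized_laplacian :: "nat \<Rightarrow> nat set set \<Rightarrow> complex mat" where
  "normalized_laplacian n E = degree_inv_sqrt n E * laplacian n E * degree_inv_sqrt n E"

text \<open>This is the cycle graph for \<open>n \<ge> 3\<close> only.\<close>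

definition cycle_edges :: "nat \<Rightarrow> nat set set" where
  "cycle_edges n = {{i, Suc i mod n} | i. i < n}"

lemma simple_graph_cycle:
  assumes "n \<ge> 3"
  shows "simple_graph n (cycle_edges n)"
proof -
  have "i \<noteq> Suc i mod n" if "i < n" for i
    using that assms by (auto simp: mod_Suc)
  then show ?thesis
    using assms by (auto simp: simple_graph_def cycle_edges_def card_2_iff)
qed

definition mat_trace :: "'a::comm_monoid_add mat \<Rightarrow> 'a" where
  "mat_trace A = (\<Sum>i<dim_row A. A $$ (i, i))"

definition mat_exp :: "complex mat \<Rightarrow> complex mat" where
  "mat_exp A = mat (dim_row A) (dim_row A) (\<lambda>(i, j). \<Sum>k. (A ^\<^sub>m k) $$ (i, j) / fact k)"

definition unitary_mat :: "nat \<Rightarrow> complex mat \<Rightarrow> bool" where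
  "unitary_mat n U \<longleftrightarrow>
     U \<in> carrier_mat n n \<and> U * mat_adjoint U = 1\<^sub>m n \<and> mat_adjoint U * U = 1\<^sub>m n"

text \<open>
  Functional calculus: \<open>f(A) = U diag(f(d\<^sub>0), \<dots>, f(d\<^sub>n\<^sub>-\<^sub>1)) U\<^sup>*\<close> for a Hermitian matrix
  \<open>A = U diag(d\<^sub>0, \<dots>, d\<^sub>n\<^sub>-\<^sub>1) U\<^sup>*\<close>. The value does not depend on the chosen
  diagonalization, see \<open>is_herm_fun_unique\<close>.
\<close>

definition is_herm_fun :: "(real \<Rightarrow> real) \<Rightarrow> complex mat \<Rightarrow> complex mat \<Rightarrow> bool" where
  "is_herm_fun f A B \<longleftrightarrow>
     (\<exists>U (d :: nat \<Rightarrow> real). unitary_mat (dim_row A) U \<and>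
        A = U * mat_diag (dim_row A) (\<lambda>i. complex_of_real (d i)) * mat_adjoint U \<and>
        B = U * mat_diag (dim_row A) (\<lambda>i. complex_of_real (f (d i))) * mat_adjoint U)"

definition herm_fun :: "(real \<Rightarrow> real) \<Rightarrow> complex mat \<Rightarrow> complex mat" where
  "herm_fun f A = (THE B. is_herm_fun f A B)"

lemma mat_adjoint_carrier: "U \<in> carrier_mat n m \<Longrightarrow> mat_adjoint U \<in> carrier_mat m n"
  by (auto simp: mat_adjoint_def)

lemma is_herm_fun_unique:
  assumes "is_herm_fun f A B" and "is_herm_fun f A C"
  shows "B = C"
proof -
  define n where "n = dim_row A"
  let ?diag = "\<lambda>d :: nat \<Rightarrow> real. mat_diag n (\<lambda>i. complex_of_real (d i))"
  obtain U d where U: "unitary_mat n U" and AU: "A = U * ?diag d * mat_adjoint U"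
    and B: "B = U * ?diag (\<lambda>i. f (d i)) * mat_adjoint U"
    using assms(1) unfolding is_herm_fun_def n_def by blast
  obtain V e where V: "unitary_mat n V" and AV: "A = V * ?diag e * mat_adjoint V"
    and C: "C = V * ?diag (\<lambda>i. f (e i)) * mat_adjoint V"
    using assms(2) unfolding is_herm_fun_def n_def by blast
  define U' V' W where "U' = mat_adjoint U" and "V' = mat_adjoint V" and "W = V' * U"
  have c [simp]: "U \<in> carrier_mat n n" "V \<in> carrier_mat n n" "U' \<in> carrier_mat n n"
      "V' \<in> carrier_mat n n" "W \<in> carrier_mat n n"
    using U V by (auto simp: unitary_mat_def U'_def V'_def W_def intro!: mat_adjoint_carrier mult_carrier_mat[of _ n n _ n])
  have cd [simp]: "?diag g \<in> carrier_mat n n" for g by simp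
  have inv: "U * U' = 1\<^sub>m n" "U' * U = 1\<^sub>m n" "V * V' = 1\<^sub>m n" "V' * V = 1\<^sub>m n"
    using U V by (auto simp: unitary_mat_def U'_def V'_def)
  have "V' * (U * ?diag d * U') * U = W * ?diag d * (U' * U)"
    unfolding W_def by (simp add: assoc_mult_mat[of _ n n _ n _ n] mult_carrier_mat[of _ n n _ n])
  then have 1: "V' * A * U = W * ?diag d"
    using inv by (simp add: AU U'_def [symmetric] right_mult_one_mat[of _ n n] mult_carrier_mat[of _ n n _ n])
  have "V' * (V * ?diag e * V') * U = (V' * V) * (?diag e * W)"
    unfolding W_def by (simp add: assoc_mult_mat[of _ n n _ n _ n] mult_carrier_mat[of _ n n _ n])
  then have 2: "V' * A * U = ?diag e * W"
    using inv by (simp add: AV V'_def [symmetric] left_mult_one_mat[of _ n n] mult_carrier_mat[of _ n n _ n])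
  have eq: "W * ?diag d = ?diag e * W" using 1 2 by simp
  have "W $$ (i, j) = 0 \<or> d j = e i" if "i < n" "j < n" for i j
    using arg_cong[OF eq, of "\<lambda>M. M $$ (i, j)"] that
    by (simp add: mat_diag_mult_left[of _ n n] mat_diag_mult_right[of _ n n])
  then have "W $$ (i, j) * complex_of_real (f (d j)) = complex_of_real (f (e i)) * W $$ (i, j)"
    if "i < n" "j < n" for i j
    using that by (metis mult.commute mult_zero_left)
  then have fd: "W * ?diag (\<lambda>i. f (d i)) = ?diag (\<lambda>i. f (e i)) * W"
    by (intro eq_matI) (auto simp: mat_diag_mult_left[of _ n n] mat_diag_mult_right[of _ n n])
  have "V * (W * ?diag (\<lambda>i. f (d i))) * U' = (V * V') * (U * ?diag (\<lambda>i. f (d i)) * U')"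
    unfolding W_def by (simp add: assoc_mult_mat[of _ n n _ n _ n] mult_carrier_mat[of _ n n _ n])
  moreover have "V * (?diag (\<lambda>i. f (e i)) * W) * U' = V * ?diag (\<lambda>i. f (e i)) * V' * (U * U')"
    unfolding W_def by (simp add: assoc_mult_mat[of _ n n _ n _ n] mult_carrier_mat[of _ n n _ n])
  ultimately show ?thesis
    using fd inv by (simp add: B C U'_def [symmetric] V'_def [symmetric] left_mult_one_mat[of _ n n]
        right_mult_one_mat[of _ n n] mult_carrier_mat[of _ n n _ n])
qed

lemma herm_fun_eqI: "is_herm_fun f A B \<Longrightarrow> herm_fun f A = B"
  unfolding herm_fun_def by (blast intro: is_herm_fun_unique)

definition gibbs_state :: "real \<Rightarrow> complex mat \<Rightarrow> complex mat" where
  "gibbs_state \<tau> H =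
     (let X = mat_exp (complex_of_real (- \<tau>) \<cdot>\<^sub>m H) in (1 / mat_trace X) \<cdot>\<^sub>m X)"

text \<open>
  Since \<open>ln 0 = 0\<close>, eigenvalue \<open>0\<close> contributes \<open>0 log 0 = 0\<close>. The trace is real for
  Hermitian \<open>\<rho>\<close>.
\<close>

definition von_neumann_entropy :: "complex mat \<Rightarrow> real" where
  "von_neumann_entropy \<rho> = Re (- mat_trace (\<rho> * herm_fun ln \<rho>))"

text \<open>
  Modified Bessel function of the first kind of real order \<open>\<alpha>\<close>, for \<open>x > 0\<close> only
  (\<open>0 powr 0 = 0\<close> spoils the value at \<open>x = 0\<close>). The reciprocal Gamma function \<open>rGamma\<close> vanishes at
  the poles of \<open>Gamma\<close>.
\<close>

definition besselI :: "real \<Rightarrow> real \<Rightarrow> real" where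
  "besselI \<alpha> x = (\<Sum>k. rGamma (real k + \<alpha> + 1) / fact k * (x / 2) powr (2 * real k + \<alpha>))"

end

theory Submission
  imports Defs
begin

text \<open>
  For \<open>n \<ge> 3\<close> the normalized Laplacian of a cycle is the circulant matrix \<open>I - A / 2\<close>, so the
  discrete Fourier matrix diagonalizes it, with eigenvalues \<open>1 - cos x\<^sub>k\<close> where
  \<open>x\<^sub>k = 2 \<pi> k / n\<close> (\<open>normalized_laplacian_cycle\<close>). For any Hermitian matrix with
  eigenvalues \<open>d\<^sub>k\<close> and partition function \<open>Z = \<Sum>\<^sub>k exp (- \<tau> d\<^sub>k)\<close>, the Gibbs state has
  eigenvalues \<open>exp (- \<tau> d\<^sub>k) / Z\<close>, hence entropy \<open>ln Z\<close> plus \<open>\<tau>\<close> times the mean energy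
  (\<open>entropy_gibbs_state\<close>). For the cycle this is an expression in the two averages
  \<open>J\<^sub>s(n) = (1 / n) \<Sum>\<^sub>k cos\<^sup>s x\<^sub>k exp (\<tau> cos x\<^sub>k)\<close> with \<open>s = 0\<close> and \<open>s = 1\<close>:
  the entropy is \<open>ln n + ln J\<^sub>0(n) - \<tau> J\<^sub>1(n) / J\<^sub>0(n)\<close>.

  It remains that \<open>J\<^sub>s(n)\<close> tends to \<open>I\<^sub>s(\<tau>)\<close> (\<open>cos_exp_mean_tendsto\<close>). The averages are Riemann
  sums of the integral representation of \<open>I\<^sub>s\<close>, but no integral is needed: expand the
  exponential into its power series. The average of \<open>cos\<^sup>m x\<^sub>k\<close> over the \<open>n\<close>-th roots
  of unity is exactly its constant Fourier coefficient as soon as \<open>n > m\<close>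
  (\<open>cos_mean_eq\<close>), so every term of the series is eventually constant in \<open>n\<close>, and
  Tannery's theorem allows the limit to be taken termwise. The limiting series is the one that
  defines \<open>I\<^sub>s(\<tau>)\<close>.
\<close>

section \<open>Entropy of Gibbs states of unitarily diagonalized matrices\<close>

definition conj_diag :: "nat \<Rightarrow> complex mat \<Rightarrow> (nat \<Rightarrow> complex) \<Rightarrow> complex mat" where
  "conj_diag n U f = U * mat_diag n f * mat_adjoint U"

lemma index_mat_adjoint:
  fixes A :: "complex mat"
  assumes "A \<in> carrier_mat n m" "i < m" "j < n"
  shows "mat_adjoint A $$ (i, j) = cnj (A $$ (j, i))"
  using assms by (simp add: mat_adjoint_def mat_of_rows_def)

lemma index_conj_diag:
  assumes U: "U \<in> carrier_mat n n" and ij: "i < n" "j < n"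
  shows "conj_diag n U f $$ (i, j) = (\<Sum>k<n. U $$ (i, k) * f k * cnj (U $$ (j, k)))"
  using assms mat_adjoint_carrier[OF U]
  by (auto simp: conj_diag_def mat_diag_mult_right[OF U] scalar_prod_def
      index_mat_adjoint[OF U] atLeast0LessThan intro!: sum.cong)

lemma conj_diag_carrier [simp]:
  assumes "U \<in> carrier_mat n n"
  shows "conj_diag n U f \<in> carrier_mat n n"
  unfolding conj_diag_def
  using assms mat_adjoint_carrier[OF assms] by (intro mult_carrier_mat[of _ n n _ n]) auto

lemma conj_diag_dim [simp]:
  assumes "U \<in> carrier_mat n n"
  shows "dim_row (conj_diag n U f) = n" "dim_col (conj_diag n U f) = n"
  using conj_diag_carrier[OF assms, of f] by auto

context
  fixes n :: nat and U :: "complex mat"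
  assumes unitary: "unitary_mat n U"
begin

lemma unitary_carrier: "U \<in> carrier_mat n n" "mat_adjoint U \<in> carrier_mat n n"
  using unitary by (auto simp: unitary_mat_def mat_adjoint_carrier)

lemma conj_diag_mult: "conj_diag n U f * conj_diag n U g = conj_diag n U (\<lambda>k. f k * g k)"
proof -
  note c = unitary_carrier
  have "conj_diag n U f * conj_diag n U g
      = U * mat_diag n f * (mat_adjoint U * U) * mat_diag n g * mat_adjoint U"
    using c by (simp add: conj_diag_def assoc_mult_mat[of _ n n _ n _ n] mult_carrier_mat[of _ n n _ n])
  also have "\<dots> = U * (mat_diag n f * mat_diag n g) * mat_adjoint U"
    using unitary c
    by (simp add: unitary_mat_def assoc_mult_mat[of _ n n _ n _ n] mult_carrier_mat[of _ n n _ n]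
        right_mult_one_mat[of _ n n] del: mat_diag_diag)
  finally show ?thesis by (simp add: conj_diag_def)
qed

lemma conj_diag_one: "conj_diag n U (\<lambda>k. 1) = 1\<^sub>m n"
  using unitary by (simp add: conj_diag_def unitary_mat_def right_mult_one_mat[of _ n n])

lemma conj_diag_pow: "conj_diag n U f ^\<^sub>m m = conj_diag n U (\<lambda>k. f k ^ m)"
proof (induction m)
  case 0
  then show ?case using conj_diag_carrier[OF unitary_carrier(1), of f] by (simp add: conj_diag_one)
next
  case (Suc m)
  then show ?case by (simp add: conj_diag_mult mult.commute)
qed

lemma conj_diag_smult: "c \<cdot>\<^sub>m conj_diag n U f = conj_diag n U (\<lambda>k. c * f k)"
  using unitary_carrier
  by (intro eq_matI) (auto simp: index_conj_diag sum_distrib_left mult_ac)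

lemma unitary_column_norm:
  assumes "k < n"
  shows "(\<Sum>i<n. U $$ (i, k) * cnj (U $$ (i, k))) = 1"
proof -
  have "(mat_adjoint U * U) $$ (k, k) = (\<Sum>i<n. U $$ (i, k) * cnj (U $$ (i, k)))"
    using unitary_carrier assms
    by (auto simp: scalar_prod_def index_mat_adjoint[of U n n] atLeast0LessThan intro!: sum.cong)
  then show ?thesis using unitary assms by (simp add: unitary_mat_def)
qed

lemma trace_conj_diag: "mat_trace (conj_diag n U f) = (\<Sum>k<n. f k)"
proof -
  have "mat_trace (conj_diag n U f) = (\<Sum>i<n. \<Sum>k<n. U $$ (i, k) * f k * cnj (U $$ (i, k)))"
    using conj_diag_carrier[OF unitary_carrier(1), of f]
    by (auto simp: mat_trace_def index_conj_diag[OF unitary_carrier(1)] intro!: sum.cong)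
  also have "\<dots> = (\<Sum>k<n. f k * (\<Sum>i<n. U $$ (i, k) * cnj (U $$ (i, k))))"
    by (subst sum.swap) (simp add: sum_distrib_left mult_ac)
  finally show ?thesis by (simp add: unitary_column_norm)
qed

text \<open>
  Each entry of the \<open>m\<close>-th power is a fixed linear combination of the \<open>m\<close>-th powers of the
  eigenvalues, so the entrywise exponential series is a finite combination of scalar ones.
\<close>

lemma mat_exp_conj_diag: "mat_exp (conj_diag n U f) = conj_diag n U (\<lambda>k. exp (f k))"
proof (rule eq_matI)
  note c = conj_diag_carrier[OF unitary_carrier(1)]
  fix i j
  assume "i < dim_row (conj_diag n U (\<lambda>k. exp (f k)))" "j < dim_col (conj_diag n U (\<lambda>k. exp (f k)))"
  then have ij: "i < n" "j < n" using c[of "\<lambda>k. exp (f k)"] by auto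
  have "(\<lambda>m. \<Sum>k<n. U $$ (i, k) * (f k ^ m /\<^sub>R fact m) * cnj (U $$ (j, k)))
      sums (\<Sum>k<n. U $$ (i, k) * exp (f k) * cnj (U $$ (j, k)))"
    by (intro sums_sum sums_mult sums_mult2 exp_converges)
  moreover have "(\<Sum>k<n. U $$ (i, k) * (f k ^ m /\<^sub>R fact m) * cnj (U $$ (j, k)))
      = (conj_diag n U f ^\<^sub>m m) $$ (i, j) / fact m" for m
    using ij by (simp add: conj_diag_pow index_conj_diag[OF unitary_carrier(1)] sum_divide_distrib
        scaleR_conv_of_real field_simps)
  ultimately show "mat_exp (conj_diag n U f) $$ (i, j) = conj_diag n U (\<lambda>k. exp (f k)) $$ (i, j)"
    using ij c[of f] by (simp add: mat_exp_def index_conj_diag[OF unitary_carrier(1)] sums_iff)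
qed (use unitary_carrier in \<open>auto simp: mat_exp_def\<close>)

lemma herm_fun_conj_diag:
  "herm_fun g (conj_diag n U (\<lambda>k. complex_of_real (d k)))
     = conj_diag n U (\<lambda>k. complex_of_real (g (d k)))"
proof (rule herm_fun_eqI)
  have "dim_row (conj_diag n U (\<lambda>k. complex_of_real (d k))) = n"
    using conj_diag_carrier[OF unitary_carrier(1)] by blast
  then show "is_herm_fun g (conj_diag n U (\<lambda>k. complex_of_real (d k)))
      (conj_diag n U (\<lambda>k. complex_of_real (g (d k))))"
    using unitary unfolding is_herm_fun_def conj_diag_def by metis
qed

text \<open>
  With \<open>p\<^sub>k = exp (- \<tau> d\<^sub>k) / Z\<close> one has \<open>- ln p\<^sub>k = \<tau> d\<^sub>k + ln Z\<close>; averaging over the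
  probability weights \<open>p\<^sub>k\<close> gives the thermodynamic identity between entropy, free energy
  and mean energy.
\<close>

lemma entropy_gibbs_state:
  fixes d :: "nat \<Rightarrow> real" and \<tau> :: real
  defines "Z \<equiv> \<Sum>k<n. exp (- \<tau> * d k)"
  assumes "n > 0"
  shows "von_neumann_entropy (gibbs_state \<tau> (conj_diag n U (\<lambda>k. complex_of_real (d k))))
           = ln Z + \<tau> * ((\<Sum>k<n. d k * exp (- \<tau> * d k)) / Z)"
proof -
  define p where "p k = exp (- \<tau> * d k) / Z" for k
  have "Z > 0" unfolding Z_def using assms by (intro sum_pos) auto
  have "mat_exp (complex_of_real (- \<tau>) \<cdot>\<^sub>m conj_diag n U (\<lambda>k. complex_of_real (d k)))
      = conj_diag n U (\<lambda>k. complex_of_real (exp (- \<tau> * d k)))"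
    by (simp only: conj_diag_smult mat_exp_conj_diag of_real_mult [symmetric] exp_of_real)
  then have "gibbs_state \<tau> (conj_diag n U (\<lambda>k. complex_of_real (d k)))
      = conj_diag n U (\<lambda>k. complex_of_real (p k))"
    by (simp add: gibbs_state_def trace_conj_diag conj_diag_smult p_def Z_def)
  then have "von_neumann_entropy (gibbs_state \<tau> (conj_diag n U (\<lambda>k. complex_of_real (d k))))
      = - (\<Sum>k<n. p k * ln (p k))"
    by (simp add: von_neumann_entropy_def herm_fun_conj_diag conj_diag_mult trace_conj_diag)
  also have "\<dots> = (\<Sum>k<n. ln Z * p k + \<tau> * (d k * exp (- \<tau> * d k)) / Z)"
    unfolding sum_negf [symmetric] using \<open>Z > 0\<close>
    by (intro sum.cong refl) (simp add: p_def ln_div field_simps)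
  also have "\<dots> = ln Z * (\<Sum>k<n. p k) + \<tau> * ((\<Sum>k<n. d k * exp (- \<tau> * d k)) / Z)"
    by (simp add: sum.distrib sum_distrib_left sum_divide_distrib)
  also have "(\<Sum>k<n. p k) = 1"
    using \<open>Z > 0\<close> by (simp add: p_def sum_divide_distrib [symmetric] Z_def)
  finally show ?thesis by simp
qed

end

section \<open>Fourier diagonalization of the cycle\<close>

text \<open>
  A geometric sum over the powers of an \<open>n\<close>-th root of unity. Stated with an integer frequency,
  it serves both the diagonalization and the cosine moments below.
\<close>

lemma sum_roots_of_unity:
  fixes a :: int
  assumes "n > 0"
  shows "(\<Sum>k<n. cis (2 * pi * of_int a * real k / real n)) = (if int n dvd a then of_nat n else 0)"
proof -
  define w where "w = cis (2 * pi * of_int a / real n)"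
  have sum: "(\<Sum>k<n. cis (2 * pi * of_int a * real k / real n)) = (\<Sum>k<n. w ^ k)"
    by (intro sum.cong refl) (simp add: w_def Complex.DeMoivre field_simps)
  have "w ^ n = 1"
    using assms by (simp add: w_def Complex.DeMoivre)
  have "w = 1 \<longleftrightarrow> int n dvd a"
  proof
    assume "w = 1"
    then have "cos (2 * pi * of_int a / real n) = 1"
      by (simp add: w_def complex_eq_iff)
    then obtain m :: int where "2 * pi * of_int a / real n = of_int m * 2 * pi"
      using cos_one_2pi_int by blast
    then have "real_of_int a = of_int (int n * m)" using assms by (simp add: field_simps)
    then show "int n dvd a" by (simp only: of_int_eq_iff) simp
  next
    assume "int n dvd a"
    then obtain m where "a = int n * m" ..
    then show "w = 1" using assms cis_multiple_2pi[of "of_int m"] by (simp add: w_def mult.assoc)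
  qed
  then show ?thesis
    using \<open>w ^ n = 1\<close> by (simp add: sum sum_gp_strict)
qed

definition fourier_mat :: "nat \<Rightarrow> complex mat" where
  "fourier_mat n = mat n n (\<lambda>(i, k). cis (2 * pi * real i * real k / real n) / sqrt (real n))"

lemma fourier_mat_carrier [simp]: "fourier_mat n \<in> carrier_mat n n"
  by (simp add: fourier_mat_def)

lemma fourier_mat_mult_cnj:
  assumes "i < n" "j < n" "k < n" "l < n"
  shows "fourier_mat n $$ (i, k) * cnj (fourier_mat n $$ (j, l))
           = cis (2 * pi * (real i * real k - real j * real l) / real n) / of_nat n"
  using assms
  by (simp add: fourier_mat_def cis_cnj cis_mult of_real_mult [symmetric] diff_divide_distrib algebra_simps
     del: of_real_mult)

lemma dvd_diff_iff_eq:
  assumes "i < n" "j < n"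
  shows "int n dvd int i - int j \<longleftrightarrow> i = j"
  using assms by (simp add: mod_eq_dvd_iff [symmetric])

lemma unitary_fourier_mat:
  assumes "n > 0"
  shows "unitary_mat n (fourier_mat n)"
proof -
  have c: "mat_adjoint (fourier_mat n) \<in> carrier_mat n n"
    by (simp add: mat_adjoint_carrier)
  have "(\<Sum>k<n. fourier_mat n $$ (i, k) * cnj (fourier_mat n $$ (j, k))) = (if i = j then 1 else 0)"
    if "i < n" "j < n" for i j
  proof -
    have "(\<Sum>k<n. fourier_mat n $$ (i, k) * cnj (fourier_mat n $$ (j, k)))
       = (\<Sum>k<n. cis (2 * pi * of_int (int i - int j) * real k / real n)) / of_nat n"
      using that by (simp add: fourier_mat_mult_cnj sum_divide_distrib algebra_simps)
    then show ?thesis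
      using that assms by (simp only: sum_roots_of_unity[OF assms] dvd_diff_iff_eq) simp
  qed
  then have 1: "fourier_mat n * mat_adjoint (fourier_mat n) = 1\<^sub>m n"
    using c carrier_matD[OF c] carrier_matD[OF fourier_mat_carrier] by (intro eq_matI)
      (auto simp: scalar_prod_def index_mat_adjoint[of _ n n] atLeast0LessThan)
  have "(\<Sum>k<n. cnj (fourier_mat n $$ (k, i)) * fourier_mat n $$ (k, j)) = (if i = j then 1 else 0)"
    if "i < n" "j < n" for i j
  proof -
    have "(\<Sum>k<n. cnj (fourier_mat n $$ (k, i)) * fourier_mat n $$ (k, j))
       = (\<Sum>k<n. cis (2 * pi * of_int (int j - int i) * real k / real n)) / of_nat n"
      using that by (subst mult.commute) (simp add: fourier_mat_mult_cnj sum_divide_distrib algebra_simps)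
    then show ?thesis
      using that assms by (simp only: sum_roots_of_unity[OF assms] dvd_diff_iff_eq) simp
  qed
  then have 2: "mat_adjoint (fourier_mat n) * fourier_mat n = 1\<^sub>m n"
    using c carrier_matD[OF c] carrier_matD[OF fourier_mat_carrier] by (intro eq_matI)
      (auto simp: scalar_prod_def index_mat_adjoint[of _ n n] atLeast0LessThan)
  show ?thesis using 1 2 by (simp add: unitary_mat_def)
qed

text \<open>
  The two edges at \<open>v\<close> lead to its successor and to its predecessor \<open>p\<close>; they are different
  because \<open>n \<ge> 3\<close>.
\<close>

lemma vertex_degree_cycle:
  assumes "n \<ge> 3" "v < n"
  shows "vertex_degree (cycle_edges n) v = 2"
proof -
  define p where "p = (if v = 0 then n - 1 else v - 1)"
  have p: "p < n" "Suc p mod n = v" using assms by (auto simp: p_def)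
  have unique: "i = p" if "i < n" "Suc i mod n = v" for i
    using that p by (auto simp: mod_Suc split: if_splits)
  have "{e \<in> cycle_edges n. v \<in> e} = {{v, Suc v mod n}, {p, v}}"
  proof (intro equalityI subsetI)
    fix e assume "e \<in> {e \<in> cycle_edges n. v \<in> e}"
    then obtain i where i: "i < n" "e = {i, Suc i mod n}" "v \<in> e" by (auto simp: cycle_edges_def)
    then show "e \<in> {{v, Suc v mod n}, {p, v}}" using unique[of i] by auto
  next
    fix e assume "e \<in> {{v, Suc v mod n}, {p, v}}"
    then show "e \<in> {e \<in> cycle_edges n. v \<in> e}"
      using p assms unfolding cycle_edges_def by blast
  qed
  moreover have "{v, Suc v mod n} \<noteq> {p, v}"
    using p assms by (auto simp: doubleton_eq_iff mod_Suc split: if_splits)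
  ultimately show ?thesis by (simp add: vertex_degree_def)
qed

lemma Suc_mod_eq_iff_dvd:
  assumes "j < n"
  shows "Suc i mod n = j \<longleftrightarrow> int n dvd int i - int j + 1"
proof -
  have "Suc i mod n = j \<longleftrightarrow> int (Suc i) mod int n = int j mod int n"
    using assms by (metis mod_less of_nat_eq_iff of_nat_mod)
  then show ?thesis by (simp add: mod_eq_dvd_iff algebra_simps)
qed

text \<open>
  Adjacency in the form in which it is produced by \<open>sum_roots_of_unity\<close>, where the indices
  \<open>i - j + 1\<close> and \<open>i - j - 1\<close> appear as frequencies.
\<close>

lemma edge_cycle_iff:
  assumes "i < n" "j < n"
  shows "{i, j} \<in> cycle_edges n \<longleftrightarrow> int n dvd int i - int j + 1 \<or> int n dvd int i - int j - 1"
proof -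
  have "{i, j} \<in> cycle_edges n \<longleftrightarrow> Suc i mod n = j \<or> Suc j mod n = i"
    using assms by (auto simp: cycle_edges_def doubleton_eq_iff)
  moreover have "int n dvd int j - int i + 1 \<longleftrightarrow> int n dvd int i - int j - 1"
    by (subst dvd_minus_iff [symmetric]) (simp add: algebra_simps)
  ultimately show ?thesis using assms by (simp add: Suc_mod_eq_iff_dvd)
qed

text \<open>
  All degrees are \<open>2\<close>, so the normalized Laplacian is \<open>I - A / 2\<close>. On the Fourier side, writing
  \<open>cos x = (cis x + cis (- x)) / 2\<close> splits the \<open>(i, j)\<close> entry into three sums over roots of
  unity, of frequencies \<open>i - j\<close> and \<open>i - j \<plusminus> 1\<close>, which detect equality and adjacency.
\<close>

lemma normalized_laplacian_cycle:
  assumes "n \<ge> 3"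
  shows "normalized_laplacian n (cycle_edges n)
    = conj_diag n (fourier_mat n) (\<lambda>k. complex_of_real (1 - cos (2 * pi * real k / real n)))"
    (is "?L = conj_diag n ?F ?d")
proof (rule eq_matI)
  have n: "n > 0" using assms by simp
  have L: "?L = mat n n (\<lambda>(i, j). (if i = j then 1 else 0) - (if {i, j} \<in> cycle_edges n then 1 / 2 else 0))"
  proof -
    have D: "degree_inv_sqrt n (cycle_edges n) = mat_diag n (\<lambda>v. complex_of_real (1 / sqrt 2))"
      unfolding degree_inv_sqrt_def mat_diag_def using assms
      by (intro eq_matI) (auto simp: vertex_degree_cycle)
    have c: "laplacian n (cycle_edges n) \<in> carrier_mat n n"
      unfolding laplacian_def degree_matrix_def adjacency_matrix_def by (intro minus_carrier_mat) simp
    have sqrt2: "complex_of_real (sqrt 2) * complex_of_real (sqrt 2) = 2"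
      by (simp flip: of_real_mult)
    show ?thesis
      unfolding normalized_laplacian_def D
      by (subst mat_diag_mult_left[OF c], subst mat_diag_mult_right[of _ n n])
        (auto simp: laplacian_def degree_matrix_def adjacency_matrix_def mat_diag_def sqrt2
           vertex_degree_cycle assms field_simps intro!: eq_matI)
  qed
  fix i j
  assume "i < dim_row (conj_diag n ?F ?d)" "j < dim_col (conj_diag n ?F ?d)"
  then have ij: "i < n" "j < n"
    using conj_diag_carrier[OF fourier_mat_carrier, of n ?d] by auto
  let ?s = "\<lambda>a::int. \<Sum>k<n. cis (2 * pi * of_int a * real k / real n)"
  let ?a = "int i - int j"
  have "?F $$ (i, k) * ?d k * cnj (?F $$ (j, k))
      = (cis (2 * pi * of_int ?a * real k / real n) - cis (2 * pi * of_int (?a + 1) * real k / real n) / 2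
         - cis (2 * pi * of_int (?a - 1) * real k / real n) / 2) / of_nat n" if "k < n" for k
  proof -
    define x where "x = 2 * pi * real k / real n"
    define y where "y = 2 * pi * of_int ?a * real k / real n"
    have "?F $$ (i, k) * cnj (?F $$ (j, k)) = cis y / of_nat n"
      using fourier_mat_mult_cnj[OF ij that that] by (simp add: y_def algebra_simps)
    then have "?F $$ (i, k) * ?d k * cnj (?F $$ (j, k)) = cis y * ?d k / of_nat n"
      by (metis mult.assoc mult.commute times_divide_eq_left)
    also have "cis y * ?d k = cis y * (1 - (cis x + cis (- x)) / 2)"
      by (simp add: complex_eq_iff x_def)
    also have "cis y * (1 - (cis x + cis (- x)) / 2) = cis y - cis (y + x) / 2 - cis (y - x) / 2"
      by (simp add: algebra_simps cis_mult add_divide_distrib)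
    also have "y + x = 2 * pi * of_int (?a + 1) * real k / real n"
      by (simp add: x_def y_def add_divide_distrib [symmetric] algebra_simps)
    also have "y - x = 2 * pi * of_int (?a - 1) * real k / real n"
      by (simp add: x_def y_def diff_divide_distrib [symmetric] algebra_simps)
    finally show ?thesis by (simp only: y_def)
  qed
  then have "conj_diag n ?F ?d $$ (i, j) = (?s ?a - ?s (?a + 1) / 2 - ?s (?a - 1) / 2) / of_nat n"
    unfolding index_conj_diag[OF fourier_mat_carrier ij] sum_divide_distrib sum_subtractf [symmetric]
    by (intro sum.cong refl) (simp only: lessThan_iff)
  also have "\<dots> = (if i = j then 1 else 0) - (if int n dvd ?a + 1 then 1 / 2 else 0)
      - (if int n dvd ?a - 1 then 1 / 2 else 0)"
    using n ij by (simp only: sum_roots_of_unity dvd_diff_iff_eq) (simp add: field_simps)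
  also have "\<dots> = (if i = j then 1 else 0) - (if {i, j} \<in> cycle_edges n then 1 / 2 else 0)"
  proof -
    \<comment> \<open>For \<open>n \<ge> 3\<close> successor and predecessor differ, so an edge is not counted twice.\<close>
    have "\<not> (int n dvd ?a + 1 \<and> int n dvd ?a - 1)"
    proof
      assume "int n dvd ?a + 1 \<and> int n dvd ?a - 1"
      then have "int n dvd (?a + 1) - (?a - 1)" by (blast intro: dvd_diff)
      then show False using assms by (auto dest: zdvd_imp_le)
    qed
    then show ?thesis using ij by (auto simp: edge_cycle_iff)
  qed
  finally show "?L $$ (i, j) = conj_diag n ?F ?d $$ (i, j)" using ij by (simp add: L)
qed (use conj_diag_carrier[OF fourier_mat_carrier, of n] in
      \<open>auto simp: normalized_laplacian_def degree_inv_sqrt_def mat_diag_def\<close>)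

section \<open>Cosine averages and Bessel functions\<close>

definition cos_mean :: "nat \<Rightarrow> nat \<Rightarrow> real" where
  "cos_mean m n = (\<Sum>k<n. cos (2 * pi * real k / real n) ^ m) / real n"

text \<open>
  Expanding \<open>((cis x + cis (- x)) / 2) ^ m\<close> gives frequencies \<open>2 i - m\<close> of absolute value at most
  \<open>m < n\<close>. The only multiple of \<open>n\<close> in this range is \<open>0\<close>, so there is no aliasing and just the
  central binomial coefficient survives.
\<close>

lemma cos_mean_eq:
  assumes "m < n"
  shows "cos_mean m n = (if even m then real (m choose (m div 2)) / 2 ^ m else 0)"
proof -
  have n: "n > 0" using assms by simp
  let ?s = "\<lambda>a::int. \<Sum>k<n. cis (2 * pi * of_int a * real k / real n)"
  have pow: "complex_of_real (cos x ^ m)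
      = (\<Sum>i\<le>m. of_nat (m choose i) * cis (of_int (2 * int i - int m) * x)) / 2 ^ m" for x
  proof -
    have "complex_of_real (cos x ^ m) = ((cis x + cis (- x)) / 2) ^ m"
      by (simp add: complex_eq_iff flip: of_real_power)
    also have "\<dots> = (\<Sum>i\<le>m. of_nat (m choose i) * cis x ^ i * cis (- x) ^ (m - i)) / 2 ^ m"
      by (simp add: power_divide binomial_ring)
    also have "(\<Sum>i\<le>m. of_nat (m choose i) * cis x ^ i * cis (- x) ^ (m - i))
        = (\<Sum>i\<le>m. of_nat (m choose i) * cis (of_int (2 * int i - int m) * x))"
      by (intro sum.cong refl) (simp add: Complex.DeMoivre cis_mult mult.assoc of_nat_diff algebra_simps)
    finally show ?thesis .
  qed
  have "complex_of_real (\<Sum>k<n. cos (2 * pi * real k / real n) ^ m)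
      = (\<Sum>k<n. \<Sum>i\<le>m. of_nat (m choose i) *
           cis (2 * pi * of_int (2 * int i - int m) * real k / real n)) / 2 ^ m"
    by (simp add: pow sum_divide_distrib mult_ac del: of_real_power)
  also have "\<dots> = (\<Sum>i\<le>m. of_nat (m choose i) * ?s (2 * int i - int m)) / 2 ^ m"
    by (subst sum.swap) (simp only: sum_distrib_left)
  also have "(\<Sum>i\<le>m. of_nat (m choose i) * ?s (2 * int i - int m))
      = (\<Sum>i\<le>m. if 2 * i = m then of_nat (m choose i) * of_nat n else 0)"
  proof (intro sum.cong refl)
    fix i assume "i \<in> {..m}"
    have "int n dvd 2 * int i - int m \<longleftrightarrow> 2 * i = m"
    proof
      assume "int n dvd 2 * int i - int m"
      moreover have "\<bar>2 * int i - int m\<bar> < int n" using assms \<open>i \<in> {..m}\<close> by auto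
      ultimately have "2 * int i - int m = 0"
        using dvd_imp_le_int[of "2 * int i - int m" "int n"] by linarith
      then show "2 * i = m" by linarith
    qed auto
    then show "of_nat (m choose i) * ?s (2 * int i - int m)
        = (if 2 * i = m then of_nat (m choose i) * of_nat n else 0)"
      using n by (simp only: sum_roots_of_unity) simp
  qed
  also have "\<dots> = (if even m then of_nat (m choose (m div 2)) * of_nat n else 0)"
  proof (cases "even m")
    case True
    then have "2 * i = m \<longleftrightarrow> i = m div 2" for i by auto
    then show ?thesis using True by simp
  qed (auto intro!: sum.neutral)
  finally have "complex_of_real (\<Sum>k<n. cos (2 * pi * real k / real n) ^ m)
      = complex_of_real ((if even m then real (m choose (m div 2)) * real n else 0) / 2 ^ m)"
    by simp
  then have "(\<Sum>k<n. cos (2 * pi * real k / real n) ^ m)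
      = (if even m then real (m choose (m div 2)) * real n else 0) / 2 ^ m"
    by (simp only: of_real_eq_iff)
  then show ?thesis using n by (simp add: cos_mean_def)
qed

lemma abs_cos_mean_le: "\<bar>cos_mean m n\<bar> \<le> 1"
proof -
  have "\<bar>\<Sum>k<n. cos (2 * pi * real k / real n) ^ m\<bar> \<le> (\<Sum>k<n. 1)"
    by (rule order.trans[OF sum_abs sum_mono]) (simp add: power_abs power_le_one)
  then show ?thesis by (cases "n = 0") (simp_all add: cos_mean_def)
qed

lemma rGamma_of_nat_plus_one: "rGamma (real k + 1) = 1 / fact k"
  using Gamma_fact[of k, where 'a = real] by (simp add: rGamma_inverse_Gamma add.commute divide_inverse)

text \<open>
  The exponential series contributes \<open>\<tau>\<^sup>m / m!\<close>, the cosine moment of order \<open>m + s\<close> contributes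
  the central binomial coefficient; nonzero moments force \<open>m = 2 j + s\<close>. Only for orders \<open>s \<le> 1\<close>
  is the product the \<open>j\<close>-th term of a single Bessel series, since higher powers
  of the cosine mix several Bessel functions.
\<close>

lemma besselI_term:
  assumes "\<tau> > 0" "s \<le> 1"
  shows "rGamma (real j + real s + 1) / fact j * (\<tau> / 2) powr (2 * real j + real s)
    = \<tau> ^ (2 * j + s) / fact (2 * j + s) * (real ((2 * j + 2 * s) choose (j + s)) / 2 ^ (2 * j + 2 * s))"
proof -
  have choose: "real ((2 * j + 2 * s) choose (j + s)) = fact (2 * j + 2 * s) / (fact (j + s) * fact (j + s))"
    by (subst binomial_fact) (auto simp: mult_2)
  have gamma: "rGamma (real j + real s + 1) = 1 / fact (j + s)"
    using rGamma_of_nat_plus_one[of "j + s"] by simp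
  have powr: "(\<tau> / 2) powr (2 * real j + real s) = (\<tau> / 2) ^ (2 * j + s)"
    using assms powr_realpow[of "\<tau> / 2" "2 * j + s"] by simp
  consider "s = 0" | "s = 1" using assms by linarith
  then show ?thesis
  proof cases
    case 1
    then show ?thesis unfolding choose gamma powr by (simp add: field_simps)
  next
    case 2
    have "(fact (2 * j + 2) :: real) = 2 * (real j + 1) * fact (2 * j + 1)"
      using fact_Suc[of "2 * j + 1", where 'a = real] by (simp add: algebra_simps)
    moreover have "(fact (j + 1) :: real) = (real j + 1) * fact j" by (simp add: algebra_simps)
    ultimately show ?thesis
      unfolding choose gamma powr unfolding 2
      by (simp add: power_divide power_add del: fact_Suc) (simp add: divide_simps del: fact_Suc)
  qed
qed

text \<open>
  Termwise limit of the exponential series by Tannery's theorem: the moments are at most \<open>1\<close>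
  in absolute value, so the series of \<open>exp \<bar>\<tau>\<bar>\<close> is a majorant.
\<close>

lemma cos_exp_mean_tendsto:
  assumes "\<tau> > 0" "s \<le> 1"
  shows "(\<lambda>n. (\<Sum>k<n. cos (2 * pi * real k / real n) ^ s
        * exp (\<tau> * cos (2 * pi * real k / real n))) / real n)
    \<longlonglongrightarrow> besselI (real s) \<tau>"
proof -
  define b where "b m = \<tau> ^ m / fact m
      * (if even (m + s) then real ((m + s) choose ((m + s) div 2)) / 2 ^ (m + s) else 0)" for m
  have expand: "(\<Sum>k<n. cos (2 * pi * real k / real n) ^ s
        * exp (\<tau> * cos (2 * pi * real k / real n))) / real n
      = (\<Sum>m. \<tau> ^ m / fact m * cos_mean (m + s) n)" for n
  proof -
    have "(\<lambda>m. (\<Sum>k<n. cos (2 * pi * real k / real n) ^ s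
          * ((\<tau> * cos (2 * pi * real k / real n)) ^ m /\<^sub>R fact m)) / real n)
        sums ((\<Sum>k<n. cos (2 * pi * real k / real n) ^ s
        * exp (\<tau> * cos (2 * pi * real k / real n))) / real n)"
      by (intro sums_sum sums_mult sums_divide exp_converges)
    moreover have "(\<Sum>k<n. cos (2 * pi * real k / real n) ^ s
          * ((\<tau> * cos (2 * pi * real k / real n)) ^ m /\<^sub>R fact m)) / real n
        = \<tau> ^ m / fact m * cos_mean (m + s) n" for m
      by (simp add: cos_mean_def sum_distrib_left sum_divide_distrib power_mult_distrib power_add field_simps)
    ultimately show ?thesis by (simp add: sums_iff)
  qed
  have "(\<lambda>n. \<Sum>m. \<tau> ^ m / fact m * cos_mean (m + s) n) \<longlonglongrightarrow> (\<Sum>m. b m)"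
  proof (rule tannerys_theorem[THEN conjunct2, THEN conjunct2])
    show "(\<lambda>n. \<tau> ^ m / fact m * cos_mean (m + s) n) \<longlonglongrightarrow> b m" for m
    proof (rule tendsto_eventually)
      show "eventually (\<lambda>n. \<tau> ^ m / fact m * cos_mean (m + s) n = b m) sequentially"
        using eventually_gt_at_top[of "m + s"] by eventually_elim (simp add: b_def cos_mean_eq)
    qed
    show "eventually (\<lambda>(m, n). norm (\<tau> ^ m / fact m * cos_mean (m + s) n) \<le> \<bar>\<tau>\<bar> ^ m / fact m)
        (at_top \<times>\<^sub>F sequentially)"
      by (intro always_eventually)
        (auto simp: abs_mult power_abs intro!: divide_right_mono mult_left_le abs_cos_mean_le)
    show "summable (\<lambda>m. \<bar>\<tau>\<bar> ^ m / fact m)"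
      using summable_exp_generic[of "\<bar>\<tau>\<bar>"] by (simp add: field_simps)
  qed auto
  also have "(\<Sum>m. b m) = (\<Sum>j. b (2 * j + s))"
  proof (rule suminf_mono_reindex[symmetric])
    show "strict_mono (\<lambda>j. 2 * j + s)" by (auto intro!: strict_monoI)
    fix m assume m: "m \<notin> range (\<lambda>j. 2 * j + s)"
    have "odd (m + s)"
    proof
      assume "even (m + s)"
      then have "m = 2 * ((m - s) div 2) + s" using assms(2) by presburger
      then show False using m by blast
    qed
    then show "b m = 0" by (simp add: b_def)
  qed
  also have "(\<Sum>j. b (2 * j + s)) = besselI (real s) \<tau>"
  proof -
    have "b (2 * j + s) = rGamma (real j + real s + 1) / fact j * (\<tau> / 2) powr (2 * real j + real s)" for j
    proof -
      have "even (2 * j + s + s)" "2 * j + s + s = 2 * j + 2 * s" "(2 * j + s + s) div 2 = j + s"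
        by simp_all
      then show ?thesis unfolding besselI_term[OF assms] b_def by (simp only: if_True)
    qed
    then show ?thesis by (simp add: besselI_def)
  qed
  finally show ?thesis by (simp only: expand)
qed

text \<open>
  The averages that converge to \<open>I\<^sub>0(\<tau>)\<close> are bounded below by \<open>exp (- \<tau>)\<close>. Positivity is what makes
  the logarithm and the quotient continuous at the limit.
\<close>

lemma besselI_0_pos:
  assumes "\<tau> > 0"
  shows "besselI 0 \<tau> > 0"
proof -
  have bound: "exp (- \<tau>) \<le> (\<Sum>k<n. cos (2 * pi * real k / real n) ^ 0
      * exp (\<tau> * cos (2 * pi * real k / real n))) / real n"
    if "n > 0" for n
  proof -
    have "(\<Sum>k<n. exp (- \<tau>)) \<le> (\<Sum>k<n. exp (\<tau> * cos (2 * pi * real k / real n)))"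
    proof (rule sum_mono)
      fix k
      have "\<tau> * (- 1) \<le> \<tau> * cos (2 * pi * real k / real n)"
        using assms by (intro mult_left_mono) auto
      then show "exp (- \<tau>) \<le> exp (\<tau> * cos (2 * pi * real k / real n))" by simp
    qed
    then show ?thesis using that by (simp add: field_simps)
  qed
  have "exp (- \<tau>) \<le> besselI (real 0) \<tau>"
    by (rule tendsto_lowerbound[OF cos_exp_mean_tendsto[OF assms]])
      (use bound in \<open>auto intro!: eventually_mono[OF eventually_gt_at_top[of 0]]\<close>)
  then show ?thesis using exp_gt_zero[of "- \<tau>"] by (simp del: exp_gt_zero)
qed

theorem mainTheorem9:
  fixes \<tau> :: real
  assumes "\<tau> > 0"
  shows "(\<lambda>n. von_neumann_entropy (gibbs_state \<tau> (normalized_laplacian n (cycle_edges n)))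
              - (ln (real n) - \<tau> * (besselI 1 \<tau> / besselI 0 \<tau>) + ln (besselI 0 \<tau>)))
         \<longlonglongrightarrow> 0"
proof -
  define J where "J s n = (\<Sum>k<n. cos (2 * pi * real k / real n) ^ s
      * exp (\<tau> * cos (2 * pi * real k / real n))) / real n" for s n :: nat
  have J0: "J 0 \<longlonglongrightarrow> besselI 0 \<tau>" and J1: "J 1 \<longlonglongrightarrow> besselI 1 \<tau>"
    using cos_exp_mean_tendsto[OF assms, of 0] cos_exp_mean_tendsto[OF assms, of 1]
    unfolding J_def by simp_all
  note pos = besselI_0_pos[OF assms]
  have entropy: "von_neumann_entropy (gibbs_state \<tau> (normalized_laplacian n (cycle_edges n)))
      = ln (real n) + ln (J 0 n) - \<tau> * (J 1 n / J 0 n)" if "n \<ge> 3" for n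
  proof -
    have n: "n > 0" using that by simp
    let ?d = "\<lambda>k. 1 - cos (2 * pi * real k / real n)"
    have weight: "exp (- \<tau> * ?d k) = exp (- \<tau>) * exp (\<tau> * cos (2 * pi * real k / real n))" for k
      by (simp add: exp_add [symmetric] algebra_simps)
    have sum: "(\<Sum>k<n. cos (2 * pi * real k / real n) ^ s * exp (\<tau> * cos (2 * pi * real k / real n)))
        = real n * J s n" for s
      using n by (simp add: J_def)
    have Z: "(\<Sum>k<n. exp (- \<tau> * ?d k)) = exp (- \<tau>) * (real n * J 0 n)"
      unfolding weight sum [symmetric] sum_distrib_left by simp
    have E: "(\<Sum>k<n. ?d k * exp (- \<tau> * ?d k)) = exp (- \<tau>) * (real n * (J 0 n - J 1 n))"
      unfolding weight unfolding right_diff_distrib sum [symmetric] sum_distrib_left sum_subtractf [symmetric]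
      by (intro sum.cong refl) (simp only: left_diff_distrib right_diff_distrib mult_ac
        mult_1_left power_0 power_one_right)
    have J: "J 0 n > 0" using n by (auto simp: J_def intro!: sum_pos divide_pos_pos)
    show ?thesis
      unfolding normalized_laplacian_cycle[OF that] entropy_gibbs_state[OF unitary_fourier_mat[OF n] n] Z E
      using n J by (simp add: ln_mult diff_divide_distrib algebra_simps)
  qed
  let ?l = "ln (besselI 0 \<tau>) - \<tau> * (besselI 1 \<tau> / besselI 0 \<tau>)"
  have "(\<lambda>n. ln (J 0 n) - \<tau> * (J 1 n / J 0 n) - ?l) \<longlonglongrightarrow> ?l - ?l"
    using pos by (intro tendsto_intros J0 J1) auto
  then show ?thesis
    by (simp, elim Lim_transform_eventually,
        intro eventually_mono[OF eventually_ge_at_top[of 3]]) (simp add: entropy)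
qed

end
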